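(* Let $\mathcal{A}=\{A_1,\dots,A_m\}$ be a finite irreducible family of real $d\times d$ matrices that has an invariant cone. Let $v$ be a simple leading eigenvector of some matrix from $\mathcal{P}_{\mathcal{A}}$, let $\{K_j\}_{j\ge0}$ be the sequence of cones produced by the Direct Algorithm with initial vector $v$, and let $K_{\min}$ be the minimal invariant cone of $\mathcal{A}$ (with its sign chosen so that $v\in K_{\min}$). Then $K_j\to K_{\min}$ as $j\to\infty$. If, in addition, all matrices of $\mathcal{A}$ are non-singular and $v$ is not an extreme vector of $K_{\min}$, then the sequence $\{K_j\}_{j\ge0}$ strictly increases and none of the cones $K_j$ is invariant for $\mathcal{A}$. In particular, none of them coincides with $K_{\min}$.
   Context: An invariant cone of $\mathcal{A}$ is a closed convex cone $K\subset\mathbb{R}^d$ with apex $0$ that is proper (nonempty interior, $K\cap(-K)=\{0\}$) and satisfies $AK\subset K$ for all $A\in\mathcal{A}$. A family is irreducible if it has no common invariant subspace other than $\{0\}$ and $\mathbb{R}^d$. An invariant cone $K$ is minimal if for every invariant cone $K'$ either $K\subset K'$ or $K\subset -K'$; an irreducible compact family having an invariant cone has a minimal one, unique up to sign, denoted $K_{\min}$. $\mathcal{P}_{\mathcal{A}}$ is the closure of the set of positive linear combinations of all products (in any order, repetitions permitted) of matrices from $\mathcal{A}$. A leading eigenvector of $A$ is an eigenvector with eigenvalue equal to the spectral radius $\rho(A)$; it is simple if it is the only eigenvector for this eigenvalue up to multiplication by a constant. Direct Algorithm: $\operatorname{cone}(X)$ denotes the conic hull of $X$. Put $\mathcal{V}_0=\{v\}$,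 $K_0=\operatorname{cone}\mathcal{V}_0$. For $j\ge1$: $\mathcal{V}_j$ is the set of all vectors $x=Ay$, $A\in\mathcal{A}$, $y\in\mathcal{V}_{j-1}$, with $x\notin K_{j-1}$, and $K_j=\operatorname{cone}\bigcup_{i=0}^{j}\mathcal{V}_i$. (The sequence is considered for all $j$, irrespective of stopping rules.) The cones $K_j$ for small $j$ may be degenerate; "none is invariant" means that for no $j$ does $AK_j\subset K_j$ hold for all $A\in\mathcal{A}$. Convergence $K_j\to K_{\min}$ means that $K_j\cap B\to K_{\min}\cap B$ in the Hausdorff metric, where $B$ is the unit ball. An extreme generator (edge) of a cone $K$ is a ray $\ell\subset K$ starting at the origin that contains no midpoint of a segment with both ends in $K\setminus\ell$; a nonzero vector on an extreme generator is called an extreme vector. *)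

theory Defs
  imports "HOL-Analysis.Analysis"
begin

definition preserves :: "(real^'n^'n) set \<Rightarrow> (real^'n) set \<Rightarrow> bool" where
  "preserves \<A> S \<longleftrightarrow> (\<forall>A\<in>\<A>. (\<lambda>x. A *v x) ` S \<subseteq> S)"

definition irreducible_family :: "(real^'n^'n) set \<Rightarrow> bool" where
  "irreducible_family \<A> \<longleftrightarrow> (\<forall>S. subspace S \<and> preserves \<A> S \<longrightarrow> S = {0} \<or> S = UNIV)"

definition proper_cone :: "(real^'n) set \<Rightarrow> bool" where
  "proper_cone K \<longleftrightarrow> closed K \<and> convex_cone K \<and> interior K \<noteq> {} \<and> K \<inter> uminus ` K = {0}"

definition invariant_cone :: "(real^'n^'n) set \<Rightarrow> (real^'n) set \<Rightarrow> bool" where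
  "invariant_cone \<A> K \<longleftrightarrow> proper_cone K \<and> preserves \<A> K"

definition minimal_invariant_cone :: "(real^'n^'n) set \<Rightarrow> (real^'n) set \<Rightarrow> bool" where
  "minimal_invariant_cone \<A> K \<longleftrightarrow> invariant_cone \<A> K \<and>
     (\<forall>K'. invariant_cone \<A> K' \<longrightarrow> K \<subseteq> K' \<or> K \<subseteq> uminus ` K')"

(* Nonempty products only; the identity is not included as an empty product. *)
inductive_set products :: "(real^'n^'n) set \<Rightarrow> (real^'n^'n) set" for \<A> where
  single: "A \<in> \<A> \<Longrightarrow> A \<in> products \<A>"
| mult: "A \<in> \<A> \<Longrightarrow> P \<in> products \<A> \<Longrightarrow> A ** P \<in> products \<A>"

definition positive_combinations :: "'a::real_vector set \<Rightarrow> 'a set" where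
  "positive_combinations X =
     {(\<Sum>x\<in>F. c x *\<^sub>R x) | F c. finite F \<and> F \<noteq> {} \<and> F \<subseteq> X \<and> (\<forall>x\<in>F. c x > 0)}"

definition product_closure :: "(real^'n^'n) set \<Rightarrow> (real^'n^'n) set" where
  "product_closure \<A> = closure (positive_combinations (products \<A>))"

(* A real matrix may have non-real eigenvalues, and the spectral radius takes these
   into account; hence eigenvalues are computed over the complex numbers. *)
definition complex_eigenvalues :: "real^'n^'n \<Rightarrow> complex set" where
  "complex_eigenvalues A =
     {z. \<exists>w :: complex^'n. w \<noteq> 0 \<and> map_matrix complex_of_real A *v w = z *s w}"

definition real_mat_spectral_radius :: "real^'n^'n \<Rightarrow> real" where
  "real_mat_spectral_radius A = Max (cmod ` complex_eigenvalues A)"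

definition leading_eigenvector :: "real^'n^'n \<Rightarrow> real^'n \<Rightarrow> bool" where
  "leading_eigenvector A v \<longleftrightarrow> v \<noteq> 0 \<and> A *v v = real_mat_spectral_radius A *\<^sub>R v"

definition simple_leading_eigenvector :: "real^'n^'n \<Rightarrow> real^'n \<Rightarrow> bool" where
  "simple_leading_eigenvector A v \<longleftrightarrow> leading_eigenvector A v \<and>
     (\<forall>w. leading_eigenvector A w \<longrightarrow> (\<exists>c. w = c *\<^sub>R v))"

(* The cone generated by X, i.e. all nonnegative linear combinations, is the library's
   convex_cone hull; its conic hull is only the union of the rays through X. *)
fun direct_vectors :: "(real^'n^'n) set \<Rightarrow> real^'n \<Rightarrow> nat \<Rightarrow> (real^'n) set" where
  "direct_vectors \<A> v 0 = {v}"
| "direct_vectors \<A> v (Suc j) =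
     {A *v y | A y. A \<in> \<A> \<and> y \<in> direct_vectors \<A> v j \<and>
        A *v y \<notin> convex_cone hull (\<Union>i\<in>{..j}. direct_vectors \<A> v i)}"

definition direct_cone :: "(real^'n^'n) set \<Rightarrow> real^'n \<Rightarrow> nat \<Rightarrow> (real^'n) set" where
  "direct_cone \<A> v j = convex_cone hull (\<Union>i\<in>{..j}. direct_vectors \<A> v i)"

(* Intended for nonempty bounded sets, where both suprema exist. *)
definition hausdorff_distance :: "'a::metric_space set \<Rightarrow> 'a set \<Rightarrow> real" where
  "hausdorff_distance X Y = max (SUP x\<in>X. infdist x Y) (SUP y\<in>Y. infdist y X)"

definition cones_converge :: "(nat \<Rightarrow> (real^'n) set) \<Rightarrow> (real^'n) set \<Rightarrow> bool" where
  "cones_converge C K \<longleftrightarrow>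
     (\<lambda>j. hausdorff_distance (C j \<inter> cball 0 1) (K \<inter> cball 0 1)) \<longlonglongrightarrow> 0"

definition ray_from_origin :: "(real^'n) set \<Rightarrow> bool" where
  "ray_from_origin l \<longleftrightarrow> (\<exists>u. u \<noteq> 0 \<and> l = {c *\<^sub>R u | c. 0 \<le> c})"

definition extreme_generator :: "(real^'n) set \<Rightarrow> (real^'n) set \<Rightarrow> bool" where
  "extreme_generator K l \<longleftrightarrow> ray_from_origin l \<and> l \<subseteq> K \<and>
     (\<forall>x\<in>K - l. \<forall>y\<in>K - l. midpoint x y \<notin> l)"

definition extreme_vector :: "(real^'n) set \<Rightarrow> real^'n \<Rightarrow> bool" where
  "extreme_vector K x \<longleftrightarrow> x \<noteq> 0 \<and> (\<exists>l. extreme_generator K l \<and> x \<in> l)"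

end

theory Submission
  imports Defs
begin

text \<open>Let \<open>limit_cone \<A> v\<close> be the closure of the union of the cones \<open>K\<^sub>j\<close> of the algorithm. A
  vector that the algorithm discards lies in the current cone, so the union is mapped into itself
  by \<open>\<A>\<close>, and the limit cone lies in every invariant cone that contains \<open>v\<close>. Irreducibility makes
  it solid, hence itself an invariant cone.

  The matrix \<open>B\<close> with simple leading eigenvector \<open>v\<close> maps every invariant cone \<open>K\<close> into itself, being
  a limit of positive combinations of products. By the Krein-Rutman theorem
  (\<open>leading_eigenvector_in_invariant_cone\<close>) \<open>K\<close> contains a leading eigenvector of \<open>B\<close>, which by
  simplicity is a multiple of \<open>v\<close>; so \<open>K\<close> contains \<open>v\<close> or \<open>- v\<close>, and then the limit cone or its
  negative. Hence the limit cone is the unique minimal invariant cone containing \<open>v\<close>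
  (\<open>minimal_invariant_cone_iff_limit_cone\<close>), and convergence only needs compactness of its slice by
  the unit ball (\<open>increasing_cones_converge\<close>).

  For the second part, an invariant \<open>K\<^sub>j\<close> is closed and contains \<open>v\<close>, so it is the limit
  cone, and if the sequence pauses at \<open>j\<close> then \<open>K\<^sub>j\<close> is invariant. So everything comes down to
  showing that the limit cone is not \<open>K\<^sub>j\<close>. Suppose it is. Then it is finitely generated, so one of
  its generators is extreme (\<open>finitely_generated_cone_has_extreme_generator\<close>). This generator is
  obtained from \<open>v\<close> by multiplying with matrices of \<open>\<A>\<close>. A non-singular matrix that maps the cone
  into itself takes non-extreme vectors to non-extreme vectors (\<open>extreme_vector_preimage\<close>), so going
  back along the product shows that \<open>v\<close> is extreme.\<close>

section \<open>Pointed closed cones\<close>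

lemma convex_cone_sum:
  assumes "convex_cone K" "\<And>i. i \<in> I \<Longrightarrow> f i \<in> K"
  shows "sum f I \<in> K"
  using assms(2)
  by (induction I rule: infinite_finite_induct)
     (auto intro: convex_cone_contains_0 convex_cone_add assms(1))

lemma convex_cone_closure:
  fixes S :: "'a::real_normed_vector set"
  assumes "convex_cone S"
  shows "convex_cone (closure S)"
proof -
  have "c *\<^sub>R x \<in> closure S" if "x \<in> closure S" "c \<ge> 0" for c x
  proof -
    have "(\<lambda>x. c *\<^sub>R x) ` closure S \<subseteq> closure ((\<lambda>x. c *\<^sub>R x) ` S)"
      by (intro closure_bounded_linear_image_subset bounded_linear_scaleR_right)
    also have "\<dots> \<subseteq> closure S"
      by (intro closure_mono) (use assms that in \<open>auto simp: convex_cone_scaleR\<close>)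
    finally show ?thesis using that by auto
  qed
  then show ?thesis
    using assms convex_closure[of S] convex_cone_nonempty[of S]
    by (auto simp: convex_cone_def conic_def)
qed

lemma proper_coneD:
  assumes "proper_cone K"
  shows "closed K" "convex_cone K" "interior K \<noteq> {}"
    and "\<And>x. x \<in> K \<Longrightarrow> - x \<in> K \<Longrightarrow> x = 0"
proof -
  show "closed K" "convex_cone K" "interior K \<noteq> {}"
    using assms by (auto simp: proper_cone_def)
  fix x assume "x \<in> K" "- x \<in> K"
  then have "x \<in> K \<inter> uminus ` K" by (metis IntI image_eqI minus_minus)
  then show "x = 0" using assms by (auto simp: proper_cone_def)
qed

text \<open>The unit vectors of \<open>K\<close> have a compact convex hull, which still avoids \<open>0\<close> because \<open>K\<close> is
  pointed. A hyperplane separating the hull from \<open>0\<close> gives a functional that dominates the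
  norm on \<open>K\<close>; its level set serves as a compact base of the cone.\<close>

lemma pointed_cone_positive_functional:
  fixes K :: "'a::euclidean_space set"
  assumes "closed K" and cc: "convex_cone K" and pointed: "\<And>x. x \<in> K \<Longrightarrow> - x \<in> K \<Longrightarrow> x = 0"
  obtains p b where "b > 0" "\<And>x. x \<in> K \<Longrightarrow> b * norm x \<le> p \<bullet> x"
proof -
  let ?S = "K \<inter> sphere 0 1"
  have "convex (K - {0})"
    unfolding convex_def
  proof safe
    fix x y :: 'a and u v :: real
    assume xy: "x \<in> K" "y \<in> K" "x \<noteq> 0" "y \<noteq> 0" and uv: "0 \<le> u" "0 \<le> v" "u + v = 1"
    have ux: "u *\<^sub>R x \<in> K" and vy: "v *\<^sub>R y \<in> K" using cc xy uv by (auto intro: convex_cone_scaleR)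
    then show "u *\<^sub>R x + v *\<^sub>R y \<in> K" using cc by (auto intro: convex_cone_add)
    assume "u *\<^sub>R x + v *\<^sub>R y = 0"
    then have eq: "v *\<^sub>R y = - (u *\<^sub>R x)" by (simp add: add_eq_0_iff)
    then have "u *\<^sub>R x = 0" using ux vy pointed by metis
    with eq xy uv show False by auto
  qed
  moreover have "?S \<subseteq> K - {0}" by auto
  ultimately have sub: "convex hull ?S \<subseteq> K - {0}" by (simp add: hull_minimal)
  have "compact ?S" using assms(1) by (simp add: closed_Int_compact)
  then have "closed (convex hull ?S)" by (simp add: compact_convex_hull compact_imp_closed)
  moreover have "0 \<notin> convex hull ?S" using sub by blast
  ultimately obtain p b where pb: "b > 0" "\<And>x. x \<in> convex hull ?S \<Longrightarrow> p \<bullet> x > b"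
    using separating_hyperplane_closed_0[of "convex hull ?S"] convex_convex_hull by metis
  show ?thesis
  proof (rule that[OF pb(1)])
    fix x assume x: "x \<in> K"
    show "b * norm x \<le> p \<bullet> x"
    proof (cases "x = 0")
      case False
      have "(1 / norm x) *\<^sub>R x \<in> ?S" using False x cc by (auto intro: convex_cone_scaleR)
      then have "p \<bullet> ((1 / norm x) *\<^sub>R x) > b" using pb(2) hull_inc by metis
      then show ?thesis using False by (simp add: field_simps)
    qed simp
  qed
qed

text \<open>An interior point of a cone is an order unit.\<close>

lemma interior_point_absorbs:
  fixes K :: "'a::euclidean_space set"
  assumes cc: "convex_cone K" and x: "x \<in> interior K"
  obtains t where "t > 0" "t *\<^sub>R x + y \<in> K" "t *\<^sub>R x - y \<in> K"
proof -
  obtain e where e: "e > 0" "cball x e \<subseteq> K" using x mem_interior_cball by blast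
  define t where "t = (norm y + 1) / e"
  have t: "t > 0" using e by (simp add: t_def add_nonneg_pos)
  have small: "norm ((1 / t) *\<^sub>R y) \<le> e"
    using e t by (simp add: t_def divide_simps)
  have "x + (1 / t) *\<^sub>R y \<in> K" "x - (1 / t) *\<^sub>R y \<in> K"
    using e(2) small by (auto simp: dist_norm subset_iff)
  then have "t *\<^sub>R (x + (1 / t) *\<^sub>R y) \<in> K" "t *\<^sub>R (x - (1 / t) *\<^sub>R y) \<in> K"
    using cc t by (auto intro!: convex_cone_scaleR)
  then show ?thesis using t that by (simp add: algebra_simps)
qed

lemma interior_add_cone:
  fixes K :: "'a::euclidean_space set"
  assumes cc: "convex_cone K" and "x \<in> K" "y \<in> interior K" "c > 0"
  shows "x + c *\<^sub>R y \<in> interior K"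
proof -
  obtain e where e: "e > 0" "ball y e \<subseteq> K" using assms mem_interior by blast
  have "ball (x + c *\<^sub>R y) (c * e) \<subseteq> K"
  proof
    fix z assume z: "z \<in> ball (x + c *\<^sub>R y) (c * e)"
    have "dist y ((1 / c) *\<^sub>R (z - x)) = (1 / c) * dist (x + c *\<^sub>R y) z"
    proof -
      have "y - (1 / c) *\<^sub>R (z - x) = (1 / c) *\<^sub>R (x + c *\<^sub>R y - z)"
        using \<open>c > 0\<close> by (simp add: algebra_simps)
      then show ?thesis using \<open>c > 0\<close> by (simp only: dist_norm norm_scaleR) simp
    qed
    also have "\<dots> < e" using z \<open>c > 0\<close> by (simp add: field_simps)
    finally have "(1 / c) *\<^sub>R (z - x) \<in> K" using e by auto
    then have "c *\<^sub>R ((1 / c) *\<^sub>R (z - x)) \<in> K" 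
      by (rule convex_cone_scaleR[OF cc less_imp_le[OF \<open>c > 0\<close>]])
    then have "x + (z - x) \<in> K" using \<open>c > 0\<close> cc assms(2) convex_cone_add by fastforce
    then show "z \<in> K" by simp
  qed
  then show ?thesis using e \<open>c > 0\<close> mem_interior by (metis mult_pos_pos)
qed

section \<open>A leading eigenvector inside an invariant cone\<close>

text \<open>The eigenvalues are the roots of the characteristic polynomial, the determinant \<open>det Q\<close> of a
  matrix of polynomials. The given point \<open>z0\<close> shows that this polynomial is not zero. Finiteness
  gives the maximum in the spectral radius its meaning.\<close>

lemma finite_complex_eigenvalues:
  assumes "z0 \<notin> complex_eigenvalues A"
  shows "finite (complex_eigenvalues A)"
proof -
  define M :: "complex \<Rightarrow> complex^'a^'a" where "M z = map_matrix complex_of_real A - mat z" for z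
  define Q :: "complex poly^'a^'a" where
    "Q = (\<chi> i j. [:complex_of_real (A $ i $ j):] - (if i = j then [:0, 1:] else 0))"
  have M: "z \<in> complex_eigenvalues A \<longleftrightarrow> det (M z) = 0" for z
  proof -
    have eq: "M z *v w = map_matrix complex_of_real A *v w - z *s w" for w
      by (simp add: M_def matrix_vector_mult_diff_rdistrib vec_eq_iff matrix_vector_mult_def mat_def
          left_diff_distrib sum_subtractf if_distrib[of "\<lambda>x. x * _"] cong: if_cong)
    have "det (M z) \<noteq> 0 \<longleftrightarrow> (\<forall>w. M z *v w = 0 \<longrightarrow> w = 0)"
      using invertible_det_nz[of "M z"] matrix_left_invertible_ker[of "M z"] invertible_left_inverse[of "M z"]
      by blast
    then show ?thesis by (auto simp: complex_eigenvalues_def eq)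
  qed
  have "poly (det Q) z = det (M z)" for z
    unfolding det_def
    by (auto simp: poly_sum poly_prod Q_def M_def mat_def sign_def intro!: sum.cong prod.cong)
  then have "complex_eigenvalues A = {z. poly (det Q) z = 0}" and "poly (det Q) z0 \<noteq> 0"
    using M assms by auto
  then show ?thesis using poly_roots_finite[of "det Q"] by fastforce
qed

text \<open>Order unit argument: the real and the imaginary part of an eigenvector for \<open>lam\<close> lie between
  multiples of \<open>- x\<close> and \<open>x\<close> in the order of \<open>K\<close>. Applying \<open>B\<close> multiplies these bounds by at
  most \<open>r\<close> each time and the eigenvector by \<open>lam\<close>, which is impossible if \<open>lam\<close> is larger
  than \<open>r\<close> in absolute value.\<close>

lemma eigenvalue_bound_by_order_unit:
  fixes B :: "real^'n^'n"
  assumes "proper_cone K" and BK: "preserves {B} K"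
    and x: "x \<in> interior K" and r: "r > 0" and Bx: "r *\<^sub>R x - B *v x \<in> K"
    and lam: "lam \<in> complex_eigenvalues B"
  shows "cmod lam \<le> r"
proof (rule ccontr)
  assume "\<not> cmod lam \<le> r"
  then have gt: "cmod lam > r" by simp
  note K = proper_coneD[OF assms(1)]
  have BK': "B *v y \<in> K" if "y \<in> K" for y using BK that by (auto simp: preserves_def)
  obtain p b where pb: "b > 0" "\<And>y. y \<in> K \<Longrightarrow> b * norm y \<le> p \<bullet> y"
    using pointed_cone_positive_functional[OF K(1,2,4)] by blast
  \<comment> \<open>Lower bounds in the order of \<open>K\<close> grow by the factor \<open>r\<close>, because \<open>B *v x\<close> is below \<open>r *\<^sub>R x\<close>.\<close>
  have order: "s *\<^sub>R x + y \<in> K \<Longrightarrow> (s * r) *\<^sub>R x + B *v y \<in> K" if "s \<ge> 0" for s y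
  proof -
    assume "s *\<^sub>R x + y \<in> K"
    from BK'[OF this] have "B *v (s *\<^sub>R x + y) + s *\<^sub>R (r *\<^sub>R x - B *v x) \<in> K"
      by (rule convex_cone_add[OF K(2) _ convex_cone_scaleR[OF K(2) that Bx]])
    then show ?thesis by (simp add: algebra_simps matrix_vector_mult_scaleR)
  qed
  have bounded: "\<exists>C. \<forall>k. norm (((\<lambda>y. B *v y) ^^ k) y) \<le> C * r ^ k" for y
  proof -
    let ?B = "\<lambda>k. ((\<lambda>y. B *v y) ^^ k)"
    obtain t where t: "t > 0" "t *\<^sub>R x + y \<in> K" "t *\<^sub>R x - y \<in> K"
      using interior_point_absorbs[OF K(2) x] by blast
    have inK: "(t * r ^ k) *\<^sub>R x + ?B k y \<in> K \<and> (t * r ^ k) *\<^sub>R x - ?B k y \<in> K" for k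
    proof (induction k)
      case (Suc k)
      have "t * r ^ k \<ge> 0" using t r by simp
      from order[OF this, of "?B k y"] order[OF this, of "- ?B k y"] Suc
      show ?case by (simp add: mult_ac linear_neg[OF matrix_vector_mul_linear])
    qed (use t in simp)
    have "norm (?B k y) \<le> (t * (p \<bullet> x) / b) * r ^ k" for k
    proof -
      have "2 * norm (?B k y) \<le> norm ((t * r ^ k) *\<^sub>R x + ?B k y) + norm ((t * r ^ k) *\<^sub>R x - ?B k y)"
        using norm_triangle_ineq4[of "(t * r ^ k) *\<^sub>R x + ?B k y" "(t * r ^ k) *\<^sub>R x - ?B k y"]
        by (simp flip: scaleR_2)
      then have "b * (2 * norm (?B k y)) \<le> b * (norm ((t * r ^ k) *\<^sub>R x + ?B k y) + norm ((t * r ^ k) *\<^sub>R x - ?B k y))"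
        using pb(1) by (intro mult_left_mono) auto
      also have "\<dots> \<le> p \<bullet> ((t * r ^ k) *\<^sub>R x + ?B k y) + p \<bullet> ((t * r ^ k) *\<^sub>R x - ?B k y)"
        unfolding distrib_left using inK[of k] by (intro add_mono pb(2)) auto
      also have "\<dots> = 2 * (t * r ^ k * (p \<bullet> x))" by (simp add: inner_add_right inner_diff_right)
      finally show ?thesis using pb(1) by (simp add: field_simps)
    qed
    then show ?thesis by blast
  qed
  obtain w :: "complex^'n" where w: "w \<noteq> 0" "map_matrix complex_of_real B *v w = lam *s w"
    using lam by (auto simp: complex_eigenvalues_def)
  then obtain i where i: "w $ i \<noteq> 0" by (auto simp: vec_eq_iff)
  have entry: "lam * w $ j = (\<Sum>l\<in>UNIV. complex_of_real (B $ j $ l) * w $ l)" for j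
    using arg_cong[OF w(2), of "\<lambda>u. u $ j"] by (simp add: matrix_vector_mult_def)
  define part :: "(complex \<Rightarrow> real) \<Rightarrow> nat \<Rightarrow> real^'n" where
    "part h k = (\<chi> j. h (lam ^ k * w $ j))" for h k
  have part: "part h k = ((\<lambda>y. B *v y) ^^ k) (part h 0)" if h: "h = Re \<or> h = Im" for h k
  proof (induction k)
    case (Suc k)
    have "part h (Suc k) = B *v part h k"
      unfolding vec_eq_iff
    proof
      fix j
      have "lam ^ Suc k * w $ j = lam ^ k * (lam * w $ j)" by (simp add: mult_ac)
      also have "\<dots> = (\<Sum>l\<in>UNIV. complex_of_real (B $ j $ l) * (lam ^ k * w $ l))"
        unfolding entry by (simp add: sum_distrib_left mult_ac)
      finally have *: "lam ^ Suc k * w $ j = (\<Sum>l\<in>UNIV. complex_of_real (B $ j $ l) * (lam ^ k * w $ l))" .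
      show "part h (Suc k) $ j = (B *v part h k) $ j"
        using h unfolding part_def vec_lambda_beta * by (auto simp: matrix_vector_mult_def)
    qed
    with Suc show ?case by simp
  qed simp
  obtain C1 C2 where C: "\<And>k. norm (part Re k) \<le> C1 * r ^ k" "\<And>k. norm (part Im k) \<le> C2 * r ^ k"
    using bounded[of "part Re 0"] bounded[of "part Im 0"] part by metis
  have le: "cmod (w $ i) * (cmod lam / r) ^ k \<le> C1 + C2" for k
  proof -
    have "cmod (w $ i) * cmod lam ^ k = cmod (lam ^ k * w $ i)" by (simp add: norm_mult norm_power)
    also have "\<dots> \<le> \<bar>part Re k $ i\<bar> + \<bar>part Im k $ i\<bar>" unfolding part_def vec_lambda_beta by (rule cmod_le)
    also have "\<dots> \<le> norm (part Re k) + norm (part Im k)"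
      by (intro add_mono component_le_norm_cart)
    also have "\<dots> \<le> (C1 + C2) * r ^ k" using C[of k] by (simp add: distrib_right)
    finally show ?thesis using r by (simp add: power_divide divide_simps)
  qed
  have "cmod lam / r > 1" using gt r by simp
  then obtain k where "(cmod lam / r) ^ k > (C1 + C2) / cmod (w $ i)" using real_arch_pow by blast
  then show False using le[of k] i by (simp add: field_simps)
qed

text \<open>Adding \<open>eps *\<^sub>R w\<close> on the base \<open>p \<bullet> x = 1\<close> amounts to the rank-one perturbation
  \<open>x \<mapsto> B *v x + (eps * (p \<bullet> x)) *\<^sub>R w\<close> of \<open>B\<close>. It sends all nonzero points of \<open>K\<close> to interior points,
  so rescaling its values gives a continuous self-map of the base, and the fixed point, a multiple
  of one of the values, is interior as well.\<close>

lemma perturbed_positive_eigenvector: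
  fixes B :: "real^'n^'n"
  assumes "proper_cone K" and "preserves {B} K"
    and pb: "b > 0" "\<And>y. y \<in> K \<Longrightarrow> b * norm y \<le> p \<bullet> y"
    and w: "w \<in> interior K" "p \<bullet> w > 0" and eps: "eps > 0"
  shows "\<exists>x r. x \<in> interior K \<and> p \<bullet> x = 1 \<and> r > 0 \<and> B *v x + eps *\<^sub>R w = r *\<^sub>R x"
proof -
  note K = proper_coneD[OF assms(1)]
  have BK': "B *v y \<in> K" if "y \<in> K" for y using assms(2) that by (auto simp: preserves_def)
  have p_nonneg: "p \<bullet> y \<ge> 0" if "y \<in> K" for y
    using order_trans[OF _ pb(2)[OF that], of 0] pb(1) by simp
  let ?S = "K \<inter> {x. p \<bullet> x = 1}"
  let ?h = "\<lambda>x. B *v x + eps *\<^sub>R w"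
  let ?g = "\<lambda>x. (1 / (p \<bullet> ?h x)) *\<^sub>R ?h x"
  have h_int: "?h x \<in> interior K" if "x \<in> K" for x
    using interior_add_cone[OF K(2) BK'[OF that] w(1) eps] .
  have h_pos: "p \<bullet> ?h x > 0" if "x \<in> K" for x
    using p_nonneg[OF BK'[OF that]] w(2) eps by (simp add: inner_add_right add_nonneg_pos)
  have "compact ?S"
  proof -
    have "bounded ?S"
      unfolding bounded_iff
    proof (intro exI ballI)
      fix x assume "x \<in> ?S"
      then show "norm x \<le> 1 / b" using pb(2)[of x] pb(1) by (simp add: field_simps)
    qed
    then show ?thesis
      using K(1) by (simp add: compact_eq_bounded_closed closed_Int closed_hyperplane)
  qed
  moreover have "convex ?S"
    using K(2) by (simp add: convex_cone_def convex_Int convex_hyperplane)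
  moreover have "(1 / (p \<bullet> w)) *\<^sub>R w \<in> ?S"
    using w interior_subset[of K] by (auto intro!: convex_cone_scaleR[OF K(2)])
  then have "?S \<noteq> {}" by blast
  moreover have "continuous_on ?S ?g"
    using h_pos by (intro continuous_intros) (auto simp: less_le)
  moreover have "?g \<in> ?S \<rightarrow> ?S"
  proof
    fix x assume x: "x \<in> ?S"
    then have "?g x \<in> K"
      using h_int[of x] h_pos[of x] interior_subset[of K] by (intro convex_cone_scaleR[OF K(2)]) auto
    moreover have "p \<bullet> ?g x = 1" using h_pos[of x] x unfolding inner_scaleR_right by simp
    ultimately show "?g x \<in> ?S" by simp
  qed
  ultimately obtain x where x: "x \<in> ?S" "?g x = x"
    by (rule brouwer)
  define r where "r = p \<bullet> ?h x"
  have r: "r > 0" using h_pos x by (simp add: r_def)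
  have gx: "x = (1 / r) *\<^sub>R ?h x" using x(2) by (simp add: r_def)
  have eq: "?h x = r *\<^sub>R x" using arg_cong[OF gx, of "scaleR r"] r by simp
  have "0 + (1 / r) *\<^sub>R ?h x \<in> interior K"
    using h_int x r by (intro interior_add_cone[OF K(2) convex_cone_contains_0[OF K(2)]]) auto
  then have "x \<in> interior K" using gx by simp
  with r eq x show ?thesis by auto
qed

text \<open>The Krein-Rutman theorem. Brouwer's fixed point theorem on a compact base of \<open>K\<close> applies
  to the perturbations of \<open>B\<close> that push \<open>K\<close> into its interior; their positive eigenvectors
  are order units, so their eigenvalues bound all eigenvalues of \<open>B\<close>. Both the
  eigenvector equation and the bound survive the passage to the limit.\<close>

theorem leading_eigenvector_in_invariant_cone:
  fixes B :: "real^'n^'n"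
  assumes "proper_cone K" and "preserves {B} K"
  obtains x where "x \<in> K" "leading_eigenvector B x"
proof -
  note K = proper_coneD[OF assms(1)]
  have BK': "B *v y \<in> K" if "y \<in> K" for y using assms(2) that by (auto simp: preserves_def)
  obtain p b where pb: "b > 0" "\<And>y. y \<in> K \<Longrightarrow> b * norm y \<le> p \<bullet> y"
    using pointed_cone_positive_functional[OF K(1,2,4)] by blast
  obtain w where w: "w \<in> interior K" using K(3) by blast
  have "w \<noteq> 0"
  proof
    assume "w = 0"
    obtain y :: "real^'n" where y: "norm y = 1" using vector_choose_size[of 1] by auto
    obtain t where "t *\<^sub>R w + y \<in> K" "t *\<^sub>R w - y \<in> K"
      using interior_point_absorbs[OF K(2) w] by blast
    with \<open>w = 0\<close> have "y = 0" using K(4)[of y] by simp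
    with y show False by simp
  qed
  then have "0 < b * norm w" using pb(1) by simp
  also have "\<dots> \<le> p \<bullet> w" using w interior_subset[of K] by (intro pb(2)) auto
  finally have pw: "p \<bullet> w > 0" .
  have "\<forall>n. \<exists>x r. x \<in> interior K \<and> p \<bullet> x = 1 \<and> r > 0 \<and> B *v x + (1 / real (Suc n)) *\<^sub>R w = r *\<^sub>R x"
    by (intro allI perturbed_positive_eigenvector[OF assms pb w pw]) auto
  then obtain X R where X: "\<And>n. X n \<in> interior K" "\<And>n. p \<bullet> X n = 1" and R: "\<And>n. R n > 0"
    and XR: "\<And>n. B *v X n + (1 / real (Suc n)) *\<^sub>R w = R n *\<^sub>R X n"
    by metis
  have XK: "X n \<in> K" for n using X(1) interior_subset by blast
  have "norm (X n) \<le> 1 / b" for n using pb(2)[OF XK[of n]] pb(1) X(2)[of n] by (simp add: field_simps)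
  then have "bounded (range X)" by (auto simp: bounded_iff)
  then obtain x s where s: "strict_mono s" "(X \<circ> s) \<longlonglongrightarrow> x"
    using bounded_imp_convergent_subsequence by blast
  have xK: "x \<in> K" using closed_sequentially[OF K(1) _ s(2)] XK by simp
  have "(\<lambda>n. p \<bullet> (X \<circ> s) n) \<longlonglongrightarrow> p \<bullet> x" using s(2) by (intro tendsto_intros)
  then have px: "p \<bullet> x = 1" using X(2) by (simp add: LIMSEQ_const_iff)
  have "(\<lambda>n. 1 / real (Suc (s n))) \<longlonglongrightarrow> 0"
    using LIMSEQ_subseq_LIMSEQ[OF LIMSEQ_inverse_real_of_nat s(1)] by (simp add: o_def inverse_eq_divide)
  from tendsto_scaleR[OF this tendsto_const[of w]]
  have "(\<lambda>n. B *v (X \<circ> s) n + (1 / real (Suc (s n))) *\<^sub>R w) \<longlonglongrightarrow> B *v x + 0 *\<^sub>R w"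
    by (intro tendsto_add bounded_linear.tendsto[OF matrix_vector_mul_bounded_linear s(2)])
  then have lim: "(\<lambda>n. R (s n) *\<^sub>R X (s n)) \<longlonglongrightarrow> B *v x" using XR by simp
  define rho where "rho = p \<bullet> (B *v x)"
  have "(\<lambda>n. p \<bullet> (R (s n) *\<^sub>R X (s n))) \<longlonglongrightarrow> rho"
    unfolding rho_def by (intro tendsto_intros lim)
  then have limR: "(\<lambda>n. R (s n)) \<longlonglongrightarrow> rho" using X(2) by simp
  from tendsto_scaleR[OF this s(2)] have "(\<lambda>n. R (s n) *\<^sub>R X (s n)) \<longlonglongrightarrow> rho *\<^sub>R x" by simp
  then have eig: "B *v x = rho *\<^sub>R x" using lim LIMSEQ_unique by blast
  have bound: "cmod lam \<le> rho" if "lam \<in> complex_eigenvalues B" for lam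
  proof -
    have "cmod lam \<le> R n" for n
    proof (rule eigenvalue_bound_by_order_unit[OF assms X(1)[of n] R _ that])
      have "R n *\<^sub>R X n - B *v X n = (1 / real (Suc n)) *\<^sub>R w" using XR[of n] by (simp add: algebra_simps)
      also have "\<dots> \<in> K" using w interior_subset[of K] by (intro convex_cone_scaleR[OF K(2)]) auto
      finally show "R n *\<^sub>R X n - B *v X n \<in> K" .
    qed
    then show ?thesis using LIMSEQ_le_const[OF limR] by blast
  qed
  have rho0: "rho \<ge> 0" using LIMSEQ_le_const[OF limR] R by (meson less_imp_le)
  have x0: "x \<noteq> 0" using px by auto
  have rho_eig: "complex_of_real rho \<in> complex_eigenvalues B"
  proof -
    let ?z = "(\<chi> i. complex_of_real (x $ i)) :: complex^'n"
    have "?z \<noteq> 0" using x0 by (auto simp: vec_eq_iff)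
    moreover have "map_matrix complex_of_real B *v ?z = complex_of_real rho *s ?z"
      unfolding vec_eq_iff
    proof
      fix i
      have "(map_matrix complex_of_real B *v ?z) $ i = complex_of_real ((B *v x) $ i)"
        by (simp add: matrix_vector_mult_def)
      then show "(map_matrix complex_of_real B *v ?z) $ i = (complex_of_real rho *s ?z) $ i"
        by (simp add: eig)
    qed
    ultimately show ?thesis unfolding complex_eigenvalues_def by blast
  qed
  \<comment> \<open>Any number beyond the bound \<open>rho\<close> is a point where the characteristic polynomial does not vanish.\<close>
  have "complex_of_real (rho + 1) \<notin> complex_eigenvalues B"
    using bound[of "complex_of_real (rho + 1)"] rho0 by (auto simp del: of_real_add)
  then have "finite (complex_eigenvalues B)" by (rule finite_complex_eigenvalues)
  then have "real_mat_spectral_radius B = rho"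
    unfolding real_mat_spectral_radius_def
  proof (intro Max_eqI)
    show "rho \<in> cmod ` complex_eigenvalues B" using rho_eig rho0 by (force intro: image_eqI)
  qed (use bound in auto)
  then have "leading_eigenvector B x" using eig x0 by (simp add: leading_eigenvector_def)
  with xK that show ?thesis by blast
qed

section \<open>The limit cone of the Direct Algorithm\<close>

text \<open>For fixed \<open>x\<close> the matrices that take \<open>x\<close> into \<open>K\<close> form a closed convex cone.\<close>

lemma product_closure_preserves:
  fixes B :: "real^'n^'n"
  assumes K: "closed K" "convex_cone K" and pres: "preserves \<A> K" and B: "B \<in> product_closure \<A>"
  shows "preserves {B} K"
proof -
  have prod: "P *v x \<in> K" if "P \<in> products \<A>" "x \<in> K" for P x
    using that
  proof (induction rule: products.induct)
    case (mult A P)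
    then show ?case using pres by (auto simp: preserves_def simp flip: matrix_vector_mul_assoc)
  qed (use pres in \<open>auto simp: preserves_def\<close>)
  have "B *v x \<in> K" if x: "x \<in> K" for x
  proof -
    have lin: "linear (\<lambda>M::real^'n^'n. M *v x)"
      by (intro linearI) (simp_all add: matrix_vector_mult_add_rdistrib scaleR_matrix_vector_assoc)
    let ?P = "{M. M *v x \<in> K}"
    have "continuous_on UNIV (\<lambda>M::real^'n^'n. M *v x)"
      using lin by (intro linear_continuous_on linear_conv_bounded_linear[THEN iffD1])
    then have "closed ?P" using closed_vimage[OF K(1)] by (simp add: vimage_def)
    moreover have "positive_combinations (products \<A>) \<subseteq> ?P"
    proof
      fix M assume "M \<in> positive_combinations (products \<A>)"
      then obtain F c where M: "M = (\<Sum>P\<in>F. c P *\<^sub>R P)" "F \<subseteq> products \<A>" "\<forall>P\<in>F. c P > 0"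
        by (auto simp: positive_combinations_def)
      have "M *v x = (\<Sum>P\<in>F. c P *\<^sub>R (P *v x))"
        unfolding M(1) by (simp add: linear_sum[OF lin] linear_cmul[OF lin])
      also have "\<dots> \<in> K" using M prod x by (intro convex_cone_sum[OF K(2)] convex_cone_scaleR[OF K(2)]) auto
      finally show "M \<in> ?P" by simp
    qed
    ultimately show ?thesis using B closure_minimal unfolding product_closure_def by blast
  qed
  then show ?thesis by (auto simp: preserves_def)
qed

lemma invariant_cone_uminus:
  assumes "invariant_cone \<A> K"
  shows "invariant_cone \<A> (uminus ` K)"
proof -
  have K: "proper_cone K" "preserves \<A> K" using assms by (auto simp: invariant_cone_def)
  have "uminus ` uminus ` K = K" by (simp add: image_image)
  moreover have "convex_cone (uminus ` K)"
    using proper_coneD(2)[OF K(1)] convex_cone_linear_image[of K uminus] by (simp add: linear_uminus)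
  moreover have "closed (uminus ` K)" "interior (uminus ` K) \<noteq> {}"
    using K(1) by (simp_all add: proper_cone_def closed_negations interior_negations)
  ultimately have "proper_cone (uminus ` K)"
    using K(1) by (simp add: proper_cone_def Int_commute)
  moreover have "preserves \<A> (uminus ` K)"
    unfolding preserves_def
  proof (intro ballI image_subsetI)
    fix A y assume "A \<in> \<A>" "y \<in> uminus ` K"
    then obtain x where "y = - x" "A *v x \<in> K" using K(2) by (auto simp: preserves_def)
    then show "A *v y \<in> uminus ` K" by (simp add: linear_neg[OF matrix_vector_mul_linear])
  qed
  ultimately show ?thesis by (simp add: invariant_cone_def)
qed

text \<open>Simplicity makes the leading eigenvector of \<open>B\<close> that lies in \<open>K\<close> a multiple of \<open>v\<close>, and only the
  sign of the factor matters for a cone.\<close>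

lemma simple_leading_eigenvector_in_cone_or_negative:
  assumes K: "invariant_cone \<A> K" and B: "B \<in> product_closure \<A>" and v: "simple_leading_eigenvector B v"
  shows "v \<in> K \<or> v \<in> uminus ` K"
proof -
  have pK: "proper_cone K" "preserves \<A> K" using K by (auto simp: invariant_cone_def)
  note KD = proper_coneD[OF pK(1)]
  obtain x where x: "x \<in> K" "leading_eigenvector B x"
    using leading_eigenvector_in_invariant_cone[OF pK(1) product_closure_preserves[OF KD(1,2) pK(2) B]] .
  obtain c where c: "x = c *\<^sub>R v" using v x(2) by (auto simp: simple_leading_eigenvector_def)
  have c0: "c \<noteq> 0" using x(2) c by (auto simp: leading_eigenvector_def)
  have "(1 / \<bar>c\<bar>) *\<^sub>R x \<in> K" by (intro convex_cone_scaleR[OF KD(2)] x) simp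
  moreover have "(1 / \<bar>c\<bar>) *\<^sub>R x = sgn c *\<^sub>R v" using c0 c by (simp add: sgn_div_norm divide_inverse)
  ultimately have "sgn c *\<^sub>R v \<in> K" by simp
  then show ?thesis using c0 by (cases c "0::real" rule: linorder_cases) force+
qed

definition limit_cone :: "(real^'n^'n) set \<Rightarrow> real^'n \<Rightarrow> (real^'n) set" where
  "limit_cone \<A> v = closure (\<Union>j. direct_cone \<A> v j)"

lemma direct_vectors_subset_direct_cone: "direct_vectors \<A> v j \<subseteq> direct_cone \<A> v j"
  unfolding direct_cone_def by (intro subsetI hull_inc) auto

lemma convex_cone_direct_cone: "convex_cone (direct_cone \<A> v j)"
  unfolding direct_cone_def by (rule convex_cone_convex_cone_hull)

lemma mono_direct_cone: "mono (direct_cone \<A> v)"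
  unfolding direct_cone_def by (intro monoI hull_mono UN_mono) auto

lemma direct_cone_start: "v \<in> direct_cone \<A> v j"
  using direct_vectors_subset_direct_cone[of \<A> v 0] monoD[OF mono_direct_cone, of 0 j \<A> v] by auto

text \<open>A vector \<open>A *v y\<close> that the algorithm discards is already in the current cone, so discarding
  never loses anything.\<close>

lemma image_direct_cone_subset:
  assumes "A \<in> \<A>"
  shows "(\<lambda>x. A *v x) ` direct_cone \<A> v j \<subseteq> direct_cone \<A> v (Suc j)"
proof -
  have gen: "A *v y \<in> direct_cone \<A> v (Suc j)" if y: "y \<in> direct_vectors \<A> v i" and i: "i \<le> j" for y i
  proof -
    have "A *v y \<in> direct_vectors \<A> v (Suc i) \<or> A *v y \<in> direct_cone \<A> v i"
      using assms y by (auto simp: direct_cone_def)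
    then have "A *v y \<in> direct_cone \<A> v (Suc i)"
      using direct_vectors_subset_direct_cone[of \<A> v "Suc i"] monoD[OF mono_direct_cone, of i "Suc i" \<A> v] by auto
    then show ?thesis using monoD[OF mono_direct_cone, of "Suc i" "Suc j" \<A> v] i by auto
  qed
  have "(\<lambda>x. A *v x) ` direct_cone \<A> v j
      = convex_cone hull ((\<lambda>x. A *v x) ` (\<Union>i\<in>{..j}. direct_vectors \<A> v i))"
    unfolding direct_cone_def by (rule convex_cone_hull_linear_image[symmetric]) simp
  also have "\<dots> \<subseteq> direct_cone \<A> v (Suc j)"
    by (intro hull_minimal convex_cone_direct_cone) (use gen in auto)
  finally show ?thesis .
qed

lemma direct_cone_subset:
  assumes "convex_cone K" "preserves \<A> K" "v \<in> K"
  shows "direct_cone \<A> v j \<subseteq> K"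
proof -
  have "direct_vectors \<A> v i \<subseteq> K" for i
    by (induction i) (use assms in \<open>auto simp: preserves_def\<close>)
  then show ?thesis unfolding direct_cone_def using assms(1) by (intro hull_minimal) auto
qed

lemma limit_cone_subset:
  assumes "closed K" "convex_cone K" "preserves \<A> K" "v \<in> K"
  shows "limit_cone \<A> v \<subseteq> K"
  unfolding limit_cone_def by (intro closure_minimal UN_least direct_cone_subset assms)

lemma direct_cone_subset_limit_cone: "direct_cone \<A> v j \<subseteq> limit_cone \<A> v"
  unfolding limit_cone_def by (rule order_trans[OF UN_upper[OF UNIV_I] closure_subset])

lemma convex_cone_limit_cone: "convex_cone (limit_cone \<A> v)"
proof -
  have "convex_cone (\<Union>j. direct_cone \<A> v j)"
    unfolding convex_cone_iff
  proof (intro conjI ballI allI impI)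
    show "0 \<in> (\<Union>j. direct_cone \<A> v j)"
      using convex_cone_contains_0[OF convex_cone_direct_cone] by blast
    fix x assume "x \<in> (\<Union>j. direct_cone \<A> v j)"
    then obtain i where i: "x \<in> direct_cone \<A> v i" by blast
    show "c *\<^sub>R x \<in> (\<Union>j. direct_cone \<A> v j)" if "0 \<le> c" for c
      using convex_cone_scaleR[OF convex_cone_direct_cone that i] by blast
    fix y assume "y \<in> (\<Union>j. direct_cone \<A> v j)"
    then obtain j where "y \<in> direct_cone \<A> v j" by blast
    then have "x \<in> direct_cone \<A> v (max i j)" "y \<in> direct_cone \<A> v (max i j)"
      using i monoD[OF mono_direct_cone, of _ "max i j" \<A> v] by (meson max.cobounded1 max.cobounded2 subsetD)+
    then show "x + y \<in> (\<Union>j. direct_cone \<A> v j)"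
      using convex_cone_add[OF convex_cone_direct_cone] by blast
  qed
  then show ?thesis unfolding limit_cone_def by (rule convex_cone_closure)
qed

lemma preserves_limit_cone: "preserves \<A> (limit_cone \<A> v)"
  unfolding preserves_def
proof
  fix A assume A: "A \<in> \<A>"
  have "(\<lambda>x. A *v x) ` limit_cone \<A> v \<subseteq> closure ((\<lambda>x. A *v x) ` (\<Union>j. direct_cone \<A> v j))"
    unfolding limit_cone_def
    by (intro closure_bounded_linear_image_subset matrix_vector_mul_bounded_linear)
  also have "\<dots> \<subseteq> limit_cone \<A> v"
    unfolding limit_cone_def image_UN
    by (intro closure_mono UN_least order_trans[OF image_direct_cone_subset[OF A]] UN_upper UNIV_I)
  finally show "(\<lambda>x. A *v x) ` limit_cone \<A> v \<subseteq> limit_cone \<A> v" .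
qed

text \<open>The span of the limit cone is a common invariant subspace, so by irreducibility it is the
  whole space, and a convex set that contains \<open>0\<close> and spans the space has interior points.\<close>

lemma invariant_limit_cone:
  assumes irr: "irreducible_family \<A>" and K: "invariant_cone \<A> K" and v: "v \<in> K" "v \<noteq> 0"
  shows "invariant_cone \<A> (limit_cone \<A> v)"
proof -
  let ?L = "limit_cone \<A> v"
  have pK: "proper_cone K" "preserves \<A> K" using K by (auto simp: invariant_cone_def)
  note KD = proper_coneD[OF pK(1)]
  have sub: "?L \<subseteq> K" using limit_cone_subset[OF KD(1,2) pK(2) v(1)] .
  have vL: "v \<in> ?L" using direct_cone_start direct_cone_subset_limit_cone by blast
  have L0: "0 \<in> ?L" by (rule convex_cone_contains_0[OF convex_cone_limit_cone])
  have "preserves \<A> (span ?L)"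
    unfolding preserves_def
  proof
    fix A assume "A \<in> \<A>"
    then have "(\<lambda>x. A *v x) ` ?L \<subseteq> ?L" using preserves_limit_cone[of \<A> v] by (auto simp: preserves_def)
    then show "(\<lambda>x. A *v x) ` span ?L \<subseteq> span ?L"
      using linear_span_image[OF matrix_vector_mul_linear, of A ?L] by (metis span_mono)
  qed
  moreover have "span ?L \<noteq> {0}" using vL v(2) span_superset by blast
  ultimately have "span ?L = UNIV" using irr by (auto simp: irreducible_family_def)
  then have "affine hull ?L = UNIV" using L0 by (simp add: affine_hull_span_0 hull_inc)
  moreover have "convex ?L" using convex_cone_limit_cone[of \<A> v] by (simp add: convex_cone_def)
  ultimately have "interior ?L \<noteq> {}"
    using rel_interior_eq_empty[of ?L] rel_interior_interior[of ?L] L0 by auto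
  moreover have "x = 0" if "x \<in> ?L" "- x \<in> ?L" for x using sub KD(4) that by blast
  then have "?L \<inter> uminus ` ?L = {0}" using L0 by (auto simp: image_iff)
  ultimately show ?thesis
    using convex_cone_limit_cone preserves_limit_cone
    by (auto simp: invariant_cone_def proper_cone_def limit_cone_def)
qed

text \<open>Every invariant cone contains \<open>v\<close> or \<open>- v\<close>, and then it contains the limit cone or its
  negative. So the limit cone is minimal, and minimality together with \<open>v \<in> K\<close> excludes the
  opposite sign.\<close>

lemma minimal_invariant_cone_iff_limit_cone:
  assumes irr: "irreducible_family \<A>" and ex: "\<exists>K. invariant_cone \<A> K"
    and B: "B \<in> product_closure \<A>" and v: "simple_leading_eigenvector B v"
  shows "minimal_invariant_cone \<A> K \<and> v \<in> K \<longleftrightarrow> K = limit_cone \<A> v"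
proof -
  let ?L = "limit_cone \<A> v"
  have v0: "v \<noteq> 0" using v by (auto simp: simple_leading_eigenvector_def leading_eigenvector_def)
  have vL: "v \<in> ?L" using direct_cone_start direct_cone_subset_limit_cone by blast
  have sub: "?L \<subseteq> K'" if "invariant_cone \<A> K'" "v \<in> K'" for K'
    using that proper_coneD(1,2) by (intro limit_cone_subset) (auto simp: invariant_cone_def)
  have signed: "v \<in> K' \<or> v \<in> uminus ` K'" if "invariant_cone \<A> K'" for K'
    using simple_leading_eigenvector_in_cone_or_negative[OF that B v] .
  obtain K0 where K0: "invariant_cone \<A> K0" "v \<in> K0"
    using ex signed invariant_cone_uminus by blast
  have inv: "invariant_cone \<A> ?L" by (rule invariant_limit_cone[OF irr K0 v0])
  have min: "minimal_invariant_cone \<A> ?L"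
    unfolding minimal_invariant_cone_def using inv sub signed invariant_cone_uminus by blast
  have "K = ?L" if K: "minimal_invariant_cone \<A> K" "v \<in> K"
  proof -
    have "\<not> K \<subseteq> uminus ` ?L"
    proof
      assume "K \<subseteq> uminus ` ?L"
      then have "v \<in> ?L \<inter> uminus ` ?L" using K(2) vL by blast
      then show False using inv v0 by (auto simp: invariant_cone_def proper_cone_def)
    qed
    then have "K \<subseteq> ?L" using K(1) inv unfolding minimal_invariant_cone_def by blast
    moreover have "?L \<subseteq> K" using sub K by (auto simp: minimal_invariant_cone_def)
    ultimately show ?thesis by blast
  qed
  then show ?thesis using min vL by blast
qed

section \<open>Convergence of increasing cones\<close>

text \<open>Points of the unit ball in the closure of the union are approximated by points of the
  union, which rescaling moves back into the ball; compactness of the slice of the limit makes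
  the approximation uniform.\<close>

lemma increasing_cones_converge:
  fixes C :: "nat \<Rightarrow> (real^'n) set"
  assumes cc: "\<And>j. convex_cone (C j)" and mono: "mono C"
  shows "cones_converge C (closure (\<Union>j. C j))"
proof -
  define L where "L = closure (\<Union>j. C j)"
  let ?X = "\<lambda>j. C j \<inter> cball 0 1" and ?Y = "L \<inter> cball 0 1"
  have X0: "0 \<in> ?X j" for j using convex_cone_contains_0[OF cc] by simp
  have CL: "C j \<subseteq> L" for j unfolding L_def by (rule order_trans[OF UN_upper[OF UNIV_I] closure_subset])
  have Y0: "0 \<in> ?Y" using X0[of 0] CL[of 0] by blast
  have "compact ?Y" by (simp add: L_def closed_Int_compact)
  have approx: "\<exists>j. infdist y (?X j) < e" if y: "y \<in> ?Y" and e: "e > 0" for y e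
  proof -
    have "y \<in> closure (\<Union>j. C j)" using y by (simp add: L_def)
    then obtain u where "u \<in> (\<Union>j. C j)" and u: "dist u y < e / 2"
      using e unfolding closure_approachable by (meson half_gt_zero)
    then obtain j where j: "u \<in> C j" by blast
    \<comment> \<open>Dividing by \<open>m\<close> pulls \<open>u\<close> back into the ball; since \<open>y\<close> is in the ball, \<open>u\<close> moves by at most its
      distance to \<open>y\<close>.\<close>
    define m where "m = max 1 (norm u)"
    have m: "m \<ge> 1" "norm u \<le> m" by (auto simp: m_def)
    have "(1 / m) *\<^sub>R u \<in> C j" using m by (intro convex_cone_scaleR[OF cc] j) auto
    moreover have "norm ((1 / m) *\<^sub>R u) \<le> 1" using m by simp
    ultimately have "(1 / m) *\<^sub>R u \<in> ?X j" by simp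
    then have "infdist y (?X j) \<le> dist y ((1 / m) *\<^sub>R u)" by (rule infdist_le)
    also have "\<dots> \<le> dist y u + dist u ((1 / m) *\<^sub>R u)" by (rule dist_triangle)
    also have "dist u ((1 / m) *\<^sub>R u) \<le> dist u y"
    proof (cases "norm u \<le> 1")
      case True
      then show ?thesis by (simp add: m_def max_absorb1)
    next
      case False
      then have mu: "m = norm u" by (simp add: m_def)
      have "u - (1 / m) *\<^sub>R u = (1 - 1 / m) *\<^sub>R u" by (simp add: algebra_simps)
      then have "dist u ((1 / m) *\<^sub>R u) = \<bar>1 - 1 / m\<bar> * norm u" by (simp add: dist_norm)
      also have "\<dots> = (1 - 1 / m) * norm u" using m(1) by simp
      also have "\<dots> = norm u - 1" using m(1) by (simp add: left_diff_distrib flip: mu)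
      also have "\<dots> \<le> norm u - norm y" using y by simp
      also have "\<dots> \<le> dist u y" by (simp add: dist_norm norm_triangle_ineq2)
      finally show ?thesis .
    qed
    finally have "infdist y (?X j) < e" using u by (simp add: dist_commute)
    then show ?thesis ..
  qed
  have infmono: "infdist y (?X k) \<le> infdist y (?X j)" if "j \<le> k" for y j k
    using monoD[OF mono that] X0[of j] by (intro infdist_mono) auto
  have bound: "\<exists>N. \<forall>j\<ge>N. norm (hausdorff_distance (?X j) ?Y) \<le> e" if e: "e > 0" for e
  proof -
    define U where "U j = {y. infdist y (?X j) < e}" for j
    have cover: "?Y \<subseteq> (\<Union>j\<in>UNIV. U j)"
      unfolding U_def using approx[OF _ e] by (intro subsetI) simp
    have "open (U j)" for j unfolding U_def by (intro open_Collect_less continuous_intros)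
    then obtain D where D: "finite D" "?Y \<subseteq> (\<Union>j\<in>D. U j)"
      using compactE_image[OF \<open>compact ?Y\<close> _ cover] by metis
    have "norm (hausdorff_distance (?X j) ?Y) \<le> e" if j: "j \<ge> Max (insert 0 D)" for j
    proof -
      have "infdist x ?Y = 0" if "x \<in> ?X j" for x
        using that CL[of j] by (intro infdist_zero) blast
      then have "(SUP x\<in>?X j. infdist x ?Y) = (SUP x\<in>?X j. 0)" by (intro SUP_cong) auto
      also have "\<dots> = 0" using X0[of j] by (intro cSUP_const) blast
      finally have "(SUP x\<in>?X j. infdist x ?Y) = 0" .
      moreover have "(SUP y\<in>?Y. infdist y (?X j)) \<le> e"
      proof (rule cSUP_least)
        fix y assume "y \<in> ?Y"
        then obtain i where i: "i \<in> D" "infdist y (?X i) < e" using D(2) unfolding U_def by auto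
        then have "i \<le> j" using j D(1) by auto
        from infmono[OF this, of y] i show "infdist y (?X j) \<le> e" by linarith
      qed (use Y0 in blast)
      ultimately show ?thesis using e by (simp add: hausdorff_distance_def)
    qed
    then show ?thesis by blast
  qed
  have "(\<lambda>j. hausdorff_distance (?X j) ?Y) \<longlonglongrightarrow> 0"
  proof (rule LIMSEQ_I)
    fix e :: real assume "e > 0"
    then obtain N where N: "\<forall>j\<ge>N. norm (hausdorff_distance (?X j) ?Y) \<le> e / 2"
      using bound[of "e / 2"] by auto
    have "norm (hausdorff_distance (?X j) ?Y - 0) < e" if "j \<ge> N" for j
      using N[rule_format, OF that] \<open>e > 0\<close> by simp
    then show "\<exists>N. \<forall>j\<ge>N. norm (hausdorff_distance (?X j) ?Y - 0) < e" by blast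
  qed
  then show ?thesis by (simp add: cones_converge_def L_def)
qed

section \<open>Extreme vectors\<close>

text \<open>The ray of an extreme generator through a nonzero \<open>x\<close> can only be the ray spanned by \<open>x\<close>.\<close>

lemma extreme_vector_iff:
  "extreme_vector K x \<longleftrightarrow> x \<noteq> 0 \<and> extreme_generator K {c *\<^sub>R x | c. 0 \<le> c}"
proof
  assume "extreme_vector K x"
  then obtain l where x: "x \<noteq> 0" "x \<in> l" and l: "extreme_generator K l"
    unfolding extreme_vector_def by blast
  from l have "ray_from_origin l" by (simp add: extreme_generator_def)
  then obtain u where u: "l = {c *\<^sub>R u | c. 0 \<le> c}" unfolding ray_from_origin_def by blast
  with x obtain a where a: "x = a *\<^sub>R u" "a \<ge> 0" by blast
  with x have a0: "a > 0" by (cases "a = 0") auto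
  have "l = {c *\<^sub>R x | c. 0 \<le> c}"
  proof safe
    fix y assume "y \<in> l"
    then obtain c where "y = c *\<^sub>R u" "c \<ge> 0" using u by blast
    then have "y = (c / a) *\<^sub>R x" "c / a \<ge> 0" using a a0 by auto
    then show "\<exists>c. y = c *\<^sub>R x \<and> 0 \<le> c" by blast
  next
    fix c :: real assume "0 \<le> c"
    then have "c *\<^sub>R x = (c * a) *\<^sub>R u" "c * a \<ge> 0" using a by auto
    then show "c *\<^sub>R x \<in> l" using u by blast
  qed
  with l x show "x \<noteq> 0 \<and> extreme_generator K {c *\<^sub>R x | c. 0 \<le> c}" by simp
next
  assume x: "x \<noteq> 0 \<and> extreme_generator K {c *\<^sub>R x | c. 0 \<le> c}"
  have "x = 1 *\<^sub>R x" by simp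
  then have "x \<in> {c *\<^sub>R x | c. 0 \<le> c}" by (metis (mono_tags, lifting) mem_Collect_eq zero_le_one)
  with x show "extreme_vector K x" unfolding extreme_vector_def by blast
qed

text \<open>An injective matrix maps the segment that witnesses non-extremality of \<open>y\<close> to one that
  witnesses it for the image.\<close>

lemma extreme_vector_preimage:
  assumes cc: "convex_cone K" and A: "invertible A" "(\<lambda>x. A *v x) ` K \<subseteq> K"
    and y: "y \<in> K" and ex: "extreme_vector K (A *v y)"
  shows "extreme_vector K y"
  unfolding extreme_vector_iff extreme_generator_def
proof (intro conjI ballI)
  let ?l = "\<lambda>x. {c *\<^sub>R x | c. 0 \<le> c}"
  have inj: "inj (\<lambda>x. A *v x)" using A(1) inj_matrix_vector_mult by blast
  have ray: "A *v x \<in> ?l (A *v y) \<longleftrightarrow> x \<in> ?l y" for x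
  proof -
    have "A *v x = c *\<^sub>R (A *v y) \<longleftrightarrow> x = c *\<^sub>R y" for c
      using injD[OF inj, of x "c *\<^sub>R y"] by (auto simp: matrix_vector_mult_scaleR)
    then show ?thesis by auto
  qed
  show y0: "y \<noteq> 0" using ex by (auto simp: extreme_vector_def)
  then show "ray_from_origin (?l y)" unfolding ray_from_origin_def by blast
  show "?l y \<subseteq> K" using y convex_cone_scaleR[OF cc] by auto
  fix a b assume ab: "a \<in> K - ?l y" "b \<in> K - ?l y"
  then have "A *v a \<in> K - ?l (A *v y)" "A *v b \<in> K - ?l (A *v y)" using A(2) ray by blast+
  then have "midpoint (A *v a) (A *v b) \<notin> ?l (A *v y)"
    using ex unfolding extreme_vector_iff extreme_generator_def by blast
  moreover have "midpoint (A *v a) (A *v b) = A *v midpoint a b"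
    by (simp add: midpoint_def matrix_vector_mult_scaleR matrix_vector_right_distrib)
  ultimately show "midpoint a b \<notin> ?l y" by (simp only: ray not_False_eq_True)
qed

text \<open>In a smallest generating set every element spans an extreme ray: if a multiple of \<open>g\<close> is a mean
  of two vectors off its ray, then subtracting their \<open>g\<close>-parts writes a multiple of \<open>g\<close> in terms of the
  other generators. A positive multiple would make \<open>g\<close> redundant, and any other one
  contradicts pointedness.\<close>

lemma finitely_generated_cone_has_extreme_generator:
  fixes G :: "(real^'n) set"
  assumes fin: "finite G" and K: "K = convex_cone hull G"
    and pointed: "\<And>x. x \<in> K \<Longrightarrow> - x \<in> K \<Longrightarrow> x = 0" and K0: "K \<noteq> {0}"
  shows "\<exists>g\<in>G. extreme_vector K g"
proof -
  define H where "H = arg_min card (\<lambda>H. H \<subseteq> G \<and> K = convex_cone hull H)"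
  have H: "H \<subseteq> G" "K = convex_cone hull H"
    and least: "\<And>H'. H' \<subseteq> G \<Longrightarrow> K = convex_cone hull H' \<Longrightarrow> card H \<le> card H'"
    using arg_min_nat_lemma[of "\<lambda>H. H \<subseteq> G \<and> K = convex_cone hull H" G card] K
    unfolding H_def by auto
  have finH: "finite H" using H(1) fin finite_subset by blast
  have "H \<noteq> {}" using H(2) K0 by auto
  then obtain g where g: "g \<in> H" by blast
  have cc: "convex_cone K" unfolding H(2) by (rule convex_cone_convex_cone_hull)
  let ?l = "{c *\<^sub>R g | c. 0 \<le> c}" and ?R = "convex_cone hull (H - {g})"
  have ccR: "convex_cone ?R" by (rule convex_cone_convex_cone_hull)
  have RK: "?R \<subseteq> K" unfolding H(2) by (intro hull_mono) auto
  have gK: "g \<in> K" unfolding H(2) using g by (rule hull_inc)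
  have gR: "g \<notin> ?R"
  proof
    assume "g \<in> ?R"
    then have "H \<subseteq> ?R" using hull_subset[of "H - {g}" convex_cone] by blast
    then have "K \<subseteq> ?R" unfolding H(2) by (intro hull_minimal ccR)
    then have "card H \<le> card (H - {g})" using RK H(1) by (intro least) auto
    then show False using g finH by (meson card_Diff1_less leD)
  qed
  then have g0: "g \<noteq> 0" using convex_cone_contains_0[OF ccR] by metis
  have decomp: "\<exists>\<alpha> a'. \<alpha> \<ge> 0 \<and> a' \<in> ?R \<and> a = \<alpha> *\<^sub>R g + a'" if "a \<in> K" for a
  proof -
    let ?D = "\<Union>x\<in>?l. \<Union>y\<in>?R. {x + y}"
    have "convex_cone ?l"
      unfolding convex_cone_iff
    proof (safe)
      show "\<exists>c. 0 = c *\<^sub>R g \<and> 0 \<le> c" by (rule exI[of _ 0]) simp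
      show "\<exists>c. a *\<^sub>R g + b *\<^sub>R g = c *\<^sub>R g \<and> 0 \<le> c" if "0 \<le> a" "0 \<le> b" for a b
        using that by (intro exI[of _ "a + b"]) (simp add: scaleR_add_left)
      show "\<exists>c. a *\<^sub>R b *\<^sub>R g = c *\<^sub>R g \<and> 0 \<le> c" if "0 \<le> a" "0 \<le> b" for a b
        using that by (intro exI[of _ "a * b"]) simp
    qed
    then have "convex_cone ?D" using ccR by (rule convex_cone_sums)
    moreover have "h \<in> ?D" if "h \<in> H" for h
    proof (cases "h = g")
      case True
      have "1 *\<^sub>R g \<in> ?l" by (intro CollectI exI[of _ 1]) simp
      then have "1 *\<^sub>R g + 0 \<in> ?D" using convex_cone_contains_0[OF ccR] by blast
      then show ?thesis using True by simp
    next
      case False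
      then have "h \<in> ?R" using that by (intro hull_inc) auto
      moreover have "0 *\<^sub>R g \<in> ?l" by (intro CollectI exI[of _ 0]) simp
      ultimately have "0 *\<^sub>R g + h \<in> ?D" by blast
      then show ?thesis by simp
    qed
    ultimately have "K \<subseteq> ?D" unfolding H(2) by (intro hull_minimal subsetI)
    with that show ?thesis by blast
  qed
  have "extreme_generator K ?l"
    unfolding extreme_generator_def
  proof (intro conjI ballI notI)
    show "ray_from_origin ?l" using g0 unfolding ray_from_origin_def by blast
    show "?l \<subseteq> K" using gK convex_cone_scaleR[OF cc] by auto
    fix a b assume a: "a \<in> K - ?l" and b: "b \<in> K - ?l" and "midpoint a b \<in> ?l"
    then obtain c where "midpoint a b = c *\<^sub>R g" by blast
    moreover have "a + b = 2 *\<^sub>R midpoint a b" by (simp add: midpoint_def)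
    ultimately have sum: "a + b = (2 * c) *\<^sub>R g" by simp
    obtain \<alpha> a' where a': "\<alpha> \<ge> 0" "a' \<in> ?R" "a = \<alpha> *\<^sub>R g + a'" using a decomp by blast
    obtain \<beta> b' where b': "\<beta> \<ge> 0" "b' \<in> ?R" "b = \<beta> *\<^sub>R g + b'" using b decomp by blast
    \<comment> \<open>The part of \<open>a + b\<close> along \<open>g\<close> that the other generators have to supply.\<close>
    define t where "t = 2 * c - \<alpha> - \<beta>"
    have t: "a' + b' = t *\<^sub>R g" using sum a' b' by (simp add: t_def algebra_simps)
    have inR: "a' + b' \<in> ?R" using a' b' by (intro convex_cone_add[OF ccR])
    show False
    proof (cases "t > 0")
      case True
      then have "(1 / t) *\<^sub>R (a' + b') \<in> ?R" by (intro convex_cone_scaleR[OF ccR] inR) simp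
      then show False using gR t True by simp
    next
      case False
      then have "(- t) *\<^sub>R g \<in> K" by (intro convex_cone_scaleR[OF cc] gK) simp
      then have "- (a' + b') \<in> K" by (simp add: t)
      then have "a' + b' = 0" using pointed inR RK by blast
      then have "- a' = b'" by (simp add: add_eq_0_iff)
      then have "a' = 0" using a' b' RK by (intro pointed) auto
      then show False using a a' by auto
    qed
  qed
  then have "extreme_vector K g" using g0 by (simp add: extreme_vector_iff)
  then show ?thesis using g H(1) by blast
qed

section \<open>Strict growth\<close>

lemma finite_direct_vectors:
  assumes "finite \<A>"
  shows "finite (direct_vectors \<A> v j)"
proof (induction j)
  case (Suc j)
  have "direct_vectors \<A> v (Suc j) \<subseteq> (\<lambda>(A, y). A *v y) ` (\<A> \<times> direct_vectors \<A> v j)" by auto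
  then show ?case using Suc assms by (meson finite_SigmaI finite_imageI finite_subset)
qed simp

text \<open>A generator of the limit cone obtained after more than zero multiplications cannot be extreme
  unless its predecessor is, so extremality descends to the initial vector.\<close>

lemma extreme_direct_vector_imp_extreme_start:
  assumes inv: "\<forall>A\<in>\<A>. invertible A"
    and "x \<in> direct_vectors \<A> v j" "extreme_vector (limit_cone \<A> v) x"
  shows "extreme_vector (limit_cone \<A> v) v"
  using assms(2,3)
proof (induction j arbitrary: x)
  case (Suc j)
  then obtain A y where A: "A \<in> \<A>" and y: "y \<in> direct_vectors \<A> v j" and x: "x = A *v y" by auto
  have "y \<in> limit_cone \<A> v"
    using y direct_vectors_subset_direct_cone direct_cone_subset_limit_cone by blast
  then have "extreme_vector (limit_cone \<A> v) y"
    using extreme_vector_preimage[OF convex_cone_limit_cone, of A \<A> v y] A inv x Suc.prems(2)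
      preserves_limit_cone[of \<A> v] by (auto simp: preserves_def)
  then show ?case using Suc.IH y by blast
qed simp

lemma direct_cone_neq_limit_cone:
  assumes fin: "finite \<A>" and inv: "\<forall>A\<in>\<A>. invertible A"
    and pointed: "\<And>x. x \<in> limit_cone \<A> v \<Longrightarrow> - x \<in> limit_cone \<A> v \<Longrightarrow> x = 0"
    and v0: "v \<noteq> 0" and nonextreme: "\<not> extreme_vector (limit_cone \<A> v) v"
  shows "direct_cone \<A> v j \<noteq> limit_cone \<A> v"
proof
  assume eq: "direct_cone \<A> v j = limit_cone \<A> v"
  let ?G = "\<Union>i\<in>{..j}. direct_vectors \<A> v i"
  have "limit_cone \<A> v = convex_cone hull ?G" using eq by (simp add: direct_cone_def)
  moreover have "limit_cone \<A> v \<noteq> {0}" using v0 eq direct_cone_start by blast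
  ultimately have "\<exists>g\<in>?G. extreme_vector (limit_cone \<A> v) g"
    using fin pointed
    by (intro finitely_generated_cone_has_extreme_generator) (auto simp: finite_direct_vectors)
  then show False using extreme_direct_vector_imp_extreme_start[OF inv] nonextreme by blast
qed

text \<open>As a finitely generated cone, \<open>K\<^sub>j\<close> is closed, so if it is mapped into itself, it contains
  the closure of the union of all the cones.\<close>

lemma preserved_direct_cone_eq_limit_cone:
  assumes "finite \<A>" "preserves \<A> (direct_cone \<A> v j)"
  shows "direct_cone \<A> v j = limit_cone \<A> v"
proof
  have "closed (direct_cone \<A> v j)"
    unfolding direct_cone_def using assms(1)
    by (intro closed_convex_cone_hull) (simp add: finite_direct_vectors)
  then show "limit_cone \<A> v \<subseteq> direct_cone \<A> v j"
    using assms(2) by (intro limit_cone_subset convex_cone_direct_cone direct_cone_start)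
qed (rule direct_cone_subset_limit_cone)

theorem theorem3:
  fixes \<A> :: "(real^'n^'n) set" and B :: "real^'n^'n" and v :: "real^'n"
  assumes "finite \<A>"
    and "irreducible_family \<A>"
    and "\<exists>K. invariant_cone \<A> K"
    and "B \<in> product_closure \<A>"
    and "simple_leading_eigenvector B v"
  shows "(\<exists>!K. minimal_invariant_cone \<A> K \<and> v \<in> K) \<and>
    (\<forall>Kmin. minimal_invariant_cone \<A> Kmin \<and> v \<in> Kmin \<longrightarrow>
       cones_converge (direct_cone \<A> v) Kmin \<and>
       ((\<forall>A\<in>\<A>. invertible A) \<and> \<not> extreme_vector Kmin v \<longrightarrow>
          strict_mono (direct_cone \<A> v) \<and>
          (\<forall>j. \<not> preserves \<A> (direct_cone \<A> v j)) \<and>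
          (\<forall>j. direct_cone \<A> v j \<noteq> Kmin)))"
proof -
  let ?L = "limit_cone \<A> v"
  have min: "minimal_invariant_cone \<A> K \<and> v \<in> K \<longleftrightarrow> K = ?L" for K
    by (rule minimal_invariant_cone_iff_limit_cone[OF assms(2-5)])
  have "proper_cone ?L"
    using min[of ?L] by (simp add: minimal_invariant_cone_def invariant_cone_def)
  note pointed = proper_coneD(4)[OF this]
  have v0: "v \<noteq> 0" using assms(5) by (auto simp: simple_leading_eigenvector_def leading_eigenvector_def)
  have conv: "cones_converge (direct_cone \<A> v) ?L"
    unfolding limit_cone_def by (rule increasing_cones_converge[OF convex_cone_direct_cone mono_direct_cone])
  have strict: "strict_mono (direct_cone \<A> v) \<and> (\<forall>j. \<not> preserves \<A> (direct_cone \<A> v j)) \<and>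
      (\<forall>j. direct_cone \<A> v j \<noteq> ?L)"
    if "\<forall>A\<in>\<A>. invertible A" "\<not> extreme_vector ?L v"
  proof -
    have neq: "direct_cone \<A> v j \<noteq> ?L" for j
      by (rule direct_cone_neq_limit_cone[OF assms(1) that(1) pointed v0 that(2)])
    then have not_inv: "\<not> preserves \<A> (direct_cone \<A> v j)" for j
      using preserved_direct_cone_eq_limit_cone[OF assms(1)] by blast
    \<comment> \<open>Each \<open>K\<^sub>j\<close> is mapped into its successor, so equality of the two would make it invariant.\<close>
    have "direct_cone \<A> v j \<subset> direct_cone \<A> v (Suc j)" for j
    proof
      show "direct_cone \<A> v j \<subseteq> direct_cone \<A> v (Suc j)" by (intro monoD[OF mono_direct_cone]) simp
      show "direct_cone \<A> v j \<noteq> direct_cone \<A> v (Suc j)"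
        using not_inv[of j] image_direct_cone_subset[of _ \<A> v j] by (auto simp: preserves_def)
    qed
    then have "strict_mono (direct_cone \<A> v)" by (simp add: strict_mono_Suc_iff)
    with neq not_inv show ?thesis by blast
  qed
  show ?thesis using min conv strict by auto
qed

end
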